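(* Let $G$ and $H$ be graphs, let $v_c\in V(G)$, and let $\widetilde{G}$ be a graph obtained from $G$ and $H$ by the $A$-cospectral construction with fixed vertex $v_c$ (defined in the context), so that $v_c^1$ and $v_c^2$ are $A$-cospectral in $\widetilde G$. Let $\widehat{G}$ be a graph obtained from $\widetilde{G}$ by the orbit-connecting modification (defined in the context). Then $v_c^1$ and $v_c^2$ are $A$-cospectral in $\widehat{G}$.
   Context: All graphs (including the constructed ones) are finite, nonempty, undirected, connected, without loops (and without multiple edges). For a graph $G$ and $v_c\in V(G)$, $\mathrm{Aut}(G,v_c)$ is the group of graph automorphisms of $G$ that fix $v_c$, and $[v_j]_{v_c}\subseteq V(G)$ is the orbit of the vertex $v_j$ under the action of $\mathrm{Aut}(G,v_c)$ on $V(G)$. $A$-cospectral construction. Take $H$ together with two copies $G^1, G^2$ of $G$ (all three vertex-disjoint). The copies of a vertex $v_j\in V(G)$ in $G^1$ and $G^2$ are denoted $v_j^1$ and $v_j^2$. Keep all edges of $G^1$, $G^2$, $H$, add no edges between $G^1$ and $G^2$, and add arbitrarily many edges between $V(G^1)$ and $V(H)$ and between $V(G^2)$ and $V(H)$ subject to the following condition: for every added edge between $v_j^1\in V(G^1)$ and $v'_\alpha\in V(H)$, a corresponding edge is added between $v'_\alpha$ and a vertex $v_m^2\in V(G^2)$ with $v_m\in[v_j]_{v_c}$, and these are all the added edges. In other words, for every $v'\in V(H)$ and every orbit $O$ of $\mathrm{Aut}(G,v_c)$ on $V(G)$, the number of neighbours of $v'$ in $\{v^1: v\in O\}$ equals the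 number of neighbours of $v'$ in $\{v^2: v\in O\}$. The resulting graph is $\widetilde G$. Orbit-connecting modification. Consider an orbit $[v_j]_{v_c}$ of $\mathrm{Aut}(G,v_c)$ on $V(G)$ and its two copies $[v_j^1]_{v_c}=\{v^1: v\in[v_j]_{v_c}\}\subseteq V(G^1)$ and $[v_j^2]_{v_c}=\{v^2: v\in[v_j]_{v_c}\}\subseteq V(G^2)$ in $\widetilde G$. Choose a bijection $[v_j^1]_{v_c}\to[v_j^2]_{v_c}$ and add to $\widetilde G$ the edges joining each vertex of $[v_j^1]_{v_c}$ to its image, so that each vertex of either copy is joined to exactly one vertex of the other copy. The resulting graph is $\widehat G$. For a graph with $n$ vertices, the vertex $v$ is associated with a standard basis vector $\boldsymbol{v}\in\mathbb{R}^n$. For a linear map (matrix) $M$ on $\mathbb{R}^n$ and $\boldsymbol{x}\in\mathbb{R}^n$, $\langle\boldsymbol{x}\rangle_M=\mathrm{span}\{\boldsymbol{x},M\boldsymbol{x},M^2\boldsymbol{x},\dots\}$. Two distinct vertices $v_i,v_j$ of a graph with adjacency matrix $A$ are $A$-cospectral if the subspaces $\langle\boldsymbol{v}_i+\boldsymbol{v}_j\rangle_A$ and $\langle\boldsymbol{v}_i-\boldsymbol{v}_j\rangle_A$ are orthogonal. *)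

theory Defs
  imports "HOL-Analysis.Analysis"
begin

text \<open>
  A graph is given by its adjacency relation on a type of class \<open>finite\<close>, all of whose
  elements are vertices. Finiteness and nonemptiness of the vertex set are therefore automatic,
  and a graph with vertex type \<open>'v\<close> has the ambient space \<^typ>\<open>real ^ 'v\<close> with
  standard basis vectors \<open>axis v 1\<close>.
\<close>

definition connected_simple_graph :: "('v::finite \<Rightarrow> 'v \<Rightarrow> bool) \<Rightarrow> bool" where
  "connected_simple_graph E \<longleftrightarrow> symp E \<and> irreflp E \<and> (\<forall>u v. E\<^sup>*\<^sup>* u v)"

definition adjacency_matrix :: "('v::finite \<Rightarrow> 'v \<Rightarrow> bool) \<Rightarrow> real ^ 'v ^ 'v" where
  "adjacency_matrix E = (\<chi> u v. if E u v then 1 else 0)"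

definition cyclic_subspace :: "real ^ 'v ^ 'v \<Rightarrow> real ^ 'v \<Rightarrow> (real ^ 'v::finite) set" where
  "cyclic_subspace M x = span (range (\<lambda>k. (((*v) M) ^^ k) x))"

definition A_cospectral :: "('v::finite \<Rightarrow> 'v \<Rightarrow> bool) \<Rightarrow> 'v \<Rightarrow> 'v \<Rightarrow> bool" where
  "A_cospectral E u v \<longleftrightarrow> u \<noteq> v \<and>
     (\<forall>x \<in> cyclic_subspace (adjacency_matrix E) (axis u 1 + axis v 1).
      \<forall>y \<in> cyclic_subspace (adjacency_matrix E) (axis u 1 - axis v 1). orthogonal x y)"

definition Aut_fixing :: "('v::finite \<Rightarrow> 'v \<Rightarrow> bool) \<Rightarrow> 'v \<Rightarrow> ('v \<Rightarrow> 'v) set" where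
  "Aut_fixing E c = {f. bij f \<and> (\<forall>u v. E (f u) (f v) \<longleftrightarrow> E u v) \<and> f c = c}"

definition Aut_orbit :: "('v::finite \<Rightarrow> 'v \<Rightarrow> bool) \<Rightarrow> 'v \<Rightarrow> 'v \<Rightarrow> 'v set" where
  "Aut_orbit E c v = (\<lambda>f. f v) ` Aut_fixing E c"

text \<open>
  The constructed graphs live on the disjoint union of two copies of the vertex set of \<open>G\<close>
  and one of the vertex set of \<open>H\<close>.
\<close>

abbreviation copy1 :: "'a \<Rightarrow> 'a + 'a + 'b" where "copy1 v \<equiv> Inl v"
abbreviation copy2 :: "'a \<Rightarrow> 'a + 'a + 'b" where "copy2 v \<equiv> Inr (Inl v)"
abbreviation inH :: "'b \<Rightarrow> 'a + 'a + 'b" where "inH w \<equiv> Inr (Inr w)"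

text \<open>
  The last conjunct is the pairing condition on the added edges: each added edge from \<open>w\<close>
  to the first copy of a vertex has its own corresponding edge from \<open>w\<close> to the second copy
  of a vertex in the same orbit, and no further edges are added. Since \<open>Gt\<close> is
  symmetric, it suffices to mention one direction of each added edge.
\<close>

definition A_cospectral_construction ::
  "('a::finite \<Rightarrow> 'a \<Rightarrow> bool) \<Rightarrow> ('b::finite \<Rightarrow> 'b \<Rightarrow> bool) \<Rightarrow> 'a
    \<Rightarrow> ('a + 'a + 'b \<Rightarrow> 'a + 'a + 'b \<Rightarrow> bool) \<Rightarrow> bool" where
  "A_cospectral_construction G H c Gt \<longleftrightarrow>
     connected_simple_graph Gt \<and>
     (\<forall>u v. Gt (copy1 u) (copy1 v) \<longleftrightarrow> G u v) \<and>
     (\<forall>u v. Gt (copy2 u) (copy2 v) \<longleftrightarrow> G u v) \<and>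
     (\<forall>w z. Gt (inH w) (inH z) \<longleftrightarrow> H w z) \<and>
     (\<forall>u v. \<not> Gt (copy1 u) (copy2 v)) \<and>
     (\<forall>w v. card {u \<in> Aut_orbit G c v. Gt (inH w) (copy1 u)} =
            card {u \<in> Aut_orbit G c v. Gt (inH w) (copy2 u)})"

definition orbit_connecting_modification ::
  "('a::finite \<Rightarrow> 'a \<Rightarrow> bool) \<Rightarrow> 'a \<Rightarrow> ('a + 'a + 'b::finite \<Rightarrow> 'a + 'a + 'b \<Rightarrow> bool)
    \<Rightarrow> ('a + 'a + 'b \<Rightarrow> 'a + 'a + 'b \<Rightarrow> bool) \<Rightarrow> bool" where
  "orbit_connecting_modification G c Gt Gh \<longleftrightarrow>
     (\<exists>v \<phi>. bij_betw \<phi> (copy1 ` Aut_orbit G c v) (copy2 ` Aut_orbit G c v) \<and>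
        (\<forall>x y. Gh x y \<longleftrightarrow> Gt x y \<or>
           (x \<in> copy1 ` Aut_orbit G c v \<and> y = \<phi> x) \<or>
           (y \<in> copy1 ` Aut_orbit G c v \<and> x = \<phi> y)))"

end

theory Submission
  imports Defs
begin

text \<open>
  The idea is to find a single subspace that separates the two cyclic subspaces. Consider the vectors
  that carry some weighting \<open>x\<close> of the vertices of \<open>G\<close> on the first copy,
  \<open>- x\<close> on the second copy and \<open>0\<close> on \<open>H\<close>, where \<open>x\<close> is constant on
  the orbits of the automorphisms of \<open>G\<close> fixing \<open>c\<close>. The adjacency matrix of
  \<open>Gh\<close> preserves this shape: the edges inside the copies commute with the automorphisms; a
  vertex of \<open>H\<close> sees equally many vertices of each orbit in the two copies, so that its
  contributions cancel; and a connecting edge joins copies of vertices of one and the same orbit, so at each end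
  it contributes the negative of the value there, whichever bijection is chosen
  (\<open>orbit_antisymmetric_invariant\<close>).

  As \<open>c\<close> is alone in its orbit, the difference of the two basis vectors has this shape, while
  their sum is orthogonal to all vectors of this shape. The adjacency matrix is symmetric, so
  it preserves the orthogonal complement as well, and the two cyclic subspaces lie in
  mutually orthogonal invariant subspaces (\<open>orthogonal_cyclic_subspaces\<close>).
\<close>

section \<open>Cyclic subspaces of a symmetric matrix\<close>

text \<open>
  A symmetric matrix that preserves \<open>W\<close> also preserves the orthogonal complement of
  \<open>W\<close>, so each cyclic subspace stays on the side of its starting vector.
\<close>

lemma orthogonal_cyclic_subspaces:
  fixes M :: "real ^ 'v ^ 'v::finite"
  assumes sym: "transpose M = M"
    and W: "subspace W" "\<And>z. z \<in> W \<Longrightarrow> M *v z \<in> W"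
    and y0: "y0 \<in> W"
    and x0: "\<And>z. z \<in> W \<Longrightarrow> orthogonal x0 z"
    and x: "x \<in> cyclic_subspace M x0"
    and y: "y \<in> cyclic_subspace M y0"
  shows "orthogonal x y"
proof -
  have "(((*v) M) ^^ k) y0 \<in> W" for k
    by (induction k) (auto intro: W y0)
  then have "cyclic_subspace M y0 \<subseteq> W"
    unfolding cyclic_subspace_def by (intro span_minimal W) auto
  then have "y \<in> W" using y by blast
  have powers: "orthogonal ((((*v) M) ^^ k) x0) z" if "z \<in> W" for k z
    using that
  proof (induction k arbitrary: z)
    case 0
    then show ?case using x0 by simp
  next
    case (Suc k)
    have "(M *v v) \<bullet> z = v \<bullet> (M *v z)" for v
      by (metis dot_lmul_matrix sym vector_transpose_matrix)
    then show ?case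
      using Suc W(2) by (simp add: orthogonal_def)
  qed
  have "orthogonal y x"
  proof (rule orthogonal_to_span)
    show "x \<in> span (range (\<lambda>k. (((*v) M) ^^ k) x0))"
      using x by (simp add: cyclic_subspace_def)
    show "orthogonal y v" if "v \<in> range (\<lambda>k. (((*v) M) ^^ k) x0)" for v
      using that powers \<open>y \<in> W\<close> by (auto simp: orthogonal_commute)
  qed
  then show ?thesis by (simp add: orthogonal_commute)
qed

lemma transpose_adjacency_matrix:
  assumes "symp E"
  shows "transpose (adjacency_matrix E) = adjacency_matrix E"
  using assms by (auto simp: transpose_def adjacency_matrix_def vec_eq_iff dest: sympD)

lemma adjacency_matrix_mult_copies:
  fixes E :: "'a::finite + 'a + 'b::finite \<Rightarrow> 'a + 'a + 'b \<Rightarrow> bool"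
  shows "(adjacency_matrix E *v z) $ i =
    (\<Sum>u | E i (copy1 u). z $ copy1 u) + (\<Sum>u | E i (copy2 u). z $ copy2 u)
      + (\<Sum>w | E i (inH w). z $ inH w)"
proof -
  have split3: "sum h UNIV = (\<Sum>u\<in>UNIV. h (copy1 u)) + (\<Sum>u\<in>UNIV. h (copy2 u)) + (\<Sum>w\<in>UNIV. h (inH w))"
    for h :: "'a + 'a + 'b \<Rightarrow> real"
    by (simp add: UNIV_Plus_UNIV [symmetric] sum.Plus add.assoc del: UNIV_Plus_UNIV)
  have "(adjacency_matrix E *v z) $ i = (\<Sum>j\<in>UNIV. if E i j then z $ j else 0)"
    by (auto simp: matrix_vector_mult_def adjacency_matrix_def intro!: sum.cong)
  then show ?thesis
    unfolding split3 by (simp add: sum.If_cases)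
qed

section \<open>Orbits of the automorphisms fixing a vertex\<close>

lemma Aut_fixing_comp:
  assumes "f \<in> Aut_fixing E c" "g \<in> Aut_fixing E c"
  shows "f \<circ> g \<in> Aut_fixing E c"
  using assms by (auto simp: Aut_fixing_def intro: bij_comp)

lemma Aut_fixing_inv:
  assumes "f \<in> Aut_fixing E c"
  shows "inv f \<in> Aut_fixing E c"
proof -
  from assms have "bij f" and E: "\<And>u v. E (f u) (f v) \<longleftrightarrow> E u v" and "f c = c"
    by (auto simp: Aut_fixing_def)
  have "E (inv f u) (inv f v) \<longleftrightarrow> E u v" for u v
    using E [of "inv f u" "inv f v"] \<open>bij f\<close> by (simp add: bij_is_surj surj_f_inv_f)
  then show ?thesis
    using \<open>bij f\<close> \<open>f c = c\<close>
    by (auto simp: Aut_fixing_def bij_imp_bij_inv bij_is_inj inv_f_eq)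
qed

lemma Aut_orbit_self: "v \<in> Aut_orbit E c v"
proof -
  have "id \<in> Aut_fixing E c"
    by (simp add: Aut_fixing_def)
  then show ?thesis
    unfolding Aut_orbit_def by (rule rev_image_eqI) simp
qed

lemma Aut_orbit_image:
  assumes "f \<in> Aut_fixing E c"
  shows "Aut_orbit E c (f v) = Aut_orbit E c v"
proof -
  have sub: "Aut_orbit E c (g u) \<subseteq> Aut_orbit E c u" if "g \<in> Aut_fixing E c" for g u
    unfolding Aut_orbit_def
  proof (clarify, rule rev_image_eqI)
    show "h \<circ> g \<in> Aut_fixing E c" if "h \<in> Aut_fixing E c" for h
      using that \<open>g \<in> Aut_fixing E c\<close> by (rule Aut_fixing_comp)
  qed simp
  have "inv f (f v) = v"
    using assms by (simp add: Aut_fixing_def bij_is_inj)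
  then show ?thesis
    using sub [OF assms, of v] sub [OF Aut_fixing_inv [OF assms], of "f v"] by auto
qed

lemma Aut_orbit_eq_iff: "Aut_orbit E c u = Aut_orbit E c v \<longleftrightarrow> u \<in> Aut_orbit E c v"
proof
  assume "Aut_orbit E c u = Aut_orbit E c v"
  then show "u \<in> Aut_orbit E c v"
    using Aut_orbit_self [of u] by blast
next
  assume "u \<in> Aut_orbit E c v"
  then obtain f where "f \<in> Aut_fixing E c" "u = f v"
    unfolding Aut_orbit_def by blast
  then show "Aut_orbit E c u = Aut_orbit E c v"
    by (simp add: Aut_orbit_image)
qed

lemma image_in_Aut_orbit_iff:
  assumes "f \<in> Aut_fixing E c"
  shows "f u \<in> Aut_orbit E c v \<longleftrightarrow> u \<in> Aut_orbit E c v"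
  using Aut_orbit_image [OF assms] by (simp flip: Aut_orbit_eq_iff)

definition orbit_constant :: "('v::finite \<Rightarrow> 'v \<Rightarrow> bool) \<Rightarrow> 'v \<Rightarrow> ('v \<Rightarrow> real) \<Rightarrow> bool" where
  "orbit_constant E c x \<longleftrightarrow> (\<forall>f \<in> Aut_fixing E c. \<forall>v. x (f v) = x v)"

lemma orbit_constantD:
  assumes "orbit_constant E c x" "u \<in> Aut_orbit E c v"
  shows "x u = x v"
  using assms by (auto simp: orbit_constant_def Aut_orbit_def)

text \<open>
  Splitting a sum into orbits, on each of which the weight factors out, leaves only the number of
  summands per orbit. This is how the pairing condition on the edges to \<open>H\<close> enters.
\<close>

lemma sum_orbit_constant_cong:
  assumes x: "orbit_constant E c x"
    and card: "\<And>v. card {u \<in> Aut_orbit E c v. P u} = card {u \<in> Aut_orbit E c v. Q u}"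
  shows "(\<Sum>u | P u. x u) = (\<Sum>u | Q u. x u)"
proof -
  have by_orbits: "(\<Sum>u | R u. x u) =
      (\<Sum>B \<in> range (Aut_orbit E c). \<Sum>u | R u \<and> Aut_orbit E c u = B. x u)" for R
    using sum.group [of "Collect R" "range (Aut_orbit E c)" "Aut_orbit E c" x]
    by (simp add: image_mono)
  have in_orbit: "(\<Sum>u | R u \<and> Aut_orbit E c u = Aut_orbit E c v. x u)
      = real (card {u \<in> Aut_orbit E c v. R u}) * x v" for R v
  proof -
    have "(\<Sum>u | R u \<and> Aut_orbit E c u = Aut_orbit E c v. x u)
        = (\<Sum>u \<in> {u \<in> Aut_orbit E c v. R u}. x v)"
    proof (rule sum.cong)
      show "x u = x v" if "u \<in> {u \<in> Aut_orbit E c v. R u}" for u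
        using that orbit_constantD [OF x, of u v] by simp
    qed (simp add: Aut_orbit_eq_iff conj_commute)
    then show ?thesis by simp
  qed
  show ?thesis
    unfolding by_orbits [of P] by_orbits [of Q]
  proof (rule sum.cong [OF refl])
    show "(\<Sum>u | P u \<and> Aut_orbit E c u = B. x u) = (\<Sum>u | Q u \<and> Aut_orbit E c u = B. x u)"
      if "B \<in> range (Aut_orbit E c)" for B
      using that in_orbit card by (elim rangeE) simp
  qed
qed

lemma orbit_constant_neighbour_sum:
  assumes x: "orbit_constant E c x"
  shows "orbit_constant E c (\<lambda>u. \<Sum>v | E u v. x v)"
  unfolding orbit_constant_def
proof (intro ballI allI)
  fix f u
  assume f: "f \<in> Aut_fixing E c"
  then have "bij f" and E: "\<And>u v. E (f u) (f v) \<longleftrightarrow> E u v"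
    by (auto simp: Aut_fixing_def)
  have "{v. E (f u) v} = f ` {v. E u v}"
  proof (intro equalityI subsetI)
    fix w
    assume "w \<in> {v. E (f u) v}"
    moreover obtain v where "w = f v"
      using \<open>bij f\<close> by (meson bij_pointE)
    ultimately show "w \<in> f ` {v. E u v}"
      using E by auto
  qed (auto simp: E)
  then have "(\<Sum>v | E (f u) v. x v) = (\<Sum>v | E u v. x (f v))"
    using \<open>bij f\<close> by (simp add: sum.reindex bij_is_inj inj_on_subset [OF bij_is_inj])
  also have "\<dots> = (\<Sum>v | E u v. x v)"
    using x f by (simp add: orbit_constant_def)
  finally show "(\<Sum>v | E (f u) v. x v) = (\<Sum>v | E u v. x v)" .
qed

section \<open>The invariant subspace\<close>

definition orbit_antisymmetric ::
  "('a::finite \<Rightarrow> 'a \<Rightarrow> bool) \<Rightarrow> 'a \<Rightarrow> (real ^ ('a + 'a + 'b::finite)) set" where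
  "orbit_antisymmetric G c =
     {z. orbit_constant G c (\<lambda>v. z $ copy1 v) \<and> (\<forall>v. z $ copy2 v = - z $ copy1 v) \<and> (\<forall>w. z $ inH w = 0)}"

lemma subspace_orbit_antisymmetric:
  fixes G :: "'a::finite \<Rightarrow> 'a \<Rightarrow> bool"
  shows "subspace (orbit_antisymmetric G c :: (real ^ ('a + 'a + 'b::finite)) set)"
proof (rule subspaceI)
  show "0 \<in> orbit_antisymmetric G c"
    by (simp add: orbit_antisymmetric_def orbit_constant_def)
  show "y + z \<in> orbit_antisymmetric G c"
    if "y \<in> orbit_antisymmetric G c" "z \<in> orbit_antisymmetric G c" for y z :: "real ^ ('a + 'a + 'b)"
    using that by (simp add: orbit_antisymmetric_def orbit_constant_def)
  show "r *\<^sub>R z \<in> orbit_antisymmetric G c"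
    if "z \<in> orbit_antisymmetric G c" for r and z :: "real ^ ('a + 'a + 'b)"
    using that by (simp add: orbit_antisymmetric_def orbit_constant_def)
qed

text \<open>
  The connecting edges are given here by a permutation \<open>\<psi>\<close> of the orbit instead of a bijection
  between its copies. On the vectors considered, they act as minus the identity on both
  copies of that orbit, so
  \<open>\<psi>\<close> disappears from the result.
\<close>

lemma orbit_antisymmetric_invariant:
  fixes G :: "'a::finite \<Rightarrow> 'a \<Rightarrow> bool"
    and E :: "'a + 'a + 'b::finite \<Rightarrow> 'a + 'a + 'b \<Rightarrow> bool"
    and c v0 :: 'a
  defines "O' \<equiv> Aut_orbit G c v0"
  assumes E11: "\<And>u v. E (copy1 u) (copy1 v) \<longleftrightarrow> G u v"
    and E22: "\<And>u v. E (copy2 u) (copy2 v) \<longleftrightarrow> G u v"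
    and E12: "\<And>u v. E (copy1 u) (copy2 v) \<longleftrightarrow> u \<in> O' \<and> v = \<psi> u"
    and E21: "\<And>u v. E (copy2 v) (copy1 u) \<longleftrightarrow> u \<in> O' \<and> v = \<psi> u"
    and \<psi>: "bij_betw \<psi> O' O'"
    and card: "\<And>w v. card {u \<in> Aut_orbit G c v. E (inH w) (copy1 u)} =
                 card {u \<in> Aut_orbit G c v. E (inH w) (copy2 u)}"
    and z: "z \<in> orbit_antisymmetric G c"
  shows "adjacency_matrix E *v z \<in> orbit_antisymmetric G c"
proof -
  let ?x = "\<lambda>v. z $ copy1 v"
  let ?Ax = "\<lambda>u. \<Sum>v | G u v. ?x v"
  let ?Az = "adjacency_matrix E *v z"
  have x: "orbit_constant G c ?x" and z2: "\<And>v. z $ copy2 v = - ?x v" and zH: "\<And>w. z $ inH w = 0"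
    using z by (auto simp: orbit_antisymmetric_def)
  have same: "?x u = ?x v" if "u \<in> O'" "v \<in> O'" for u v
    using orbit_constantD [OF x] that unfolding O'_def by metis
  have Az1: "?Az $ copy1 u = ?Ax u - (if u \<in> O' then ?x u else 0)" for u
  proof (cases "u \<in> O'")
    case True
    then have "{v. E (copy1 u) (copy2 v)} = {\<psi> u}"
      using E12 by auto
    moreover have "?x (\<psi> u) = ?x u"
      using \<psi> True by (intro same) (auto simp: bij_betw_def)
    ultimately show ?thesis
      using True by (simp add: adjacency_matrix_mult_copies E11 z2 zH)
  next
    case False
    then show ?thesis
      by (simp add: adjacency_matrix_mult_copies E11 E12 zH)
  qed
  have Az2: "?Az $ copy2 v = - ?Ax v + (if v \<in> O' then ?x v else 0)" for v
  proof (cases "v \<in> O'")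
    case True
    then obtain u where u: "u \<in> O'" "v = \<psi> u"
      using \<psi> by (auto simp: bij_betw_def)
    then have "{u'. E (copy2 v) (copy1 u')} = {u}"
      using E21 \<psi> by (auto simp: bij_betw_def inj_on_def)
    moreover have "?x u = ?x v"
      using u True by (intro same)
    ultimately show ?thesis
      using True by (simp add: adjacency_matrix_mult_copies E22 z2 zH sum_negf)
  next
    case False
    then have "{u'. E (copy2 v) (copy1 u')} = {}"
      using E21 \<psi> by (auto simp: bij_betw_def)
    then show ?thesis
      using False by (simp add: adjacency_matrix_mult_copies E22 z2 zH sum_negf)
  qed
  have AzH: "?Az $ inH w = 0" for w
    using sum_orbit_constant_cong [OF x card [of _ w]]
    by (simp add: adjacency_matrix_mult_copies z2 zH sum_negf)
  have "orbit_constant G c (\<lambda>u. ?Ax u - (if u \<in> O' then ?x u else 0))"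
    unfolding orbit_constant_def
  proof (intro ballI allI)
    fix f v
    assume f: "f \<in> Aut_fixing G c"
    have "?x (f v) = ?x v"
      using x f unfolding orbit_constant_def by blast
    moreover have "?Ax (f v) = ?Ax v"
      using orbit_constant_neighbour_sum [OF x] f unfolding orbit_constant_def by blast
    moreover have "f v \<in> O' \<longleftrightarrow> v \<in> O'"
      unfolding O'_def using f by (rule image_in_Aut_orbit_iff)
    ultimately show "?Ax (f v) - (if f v \<in> O' then ?x (f v) else 0) =
        ?Ax v - (if v \<in> O' then ?x v else 0)"
      by simp
  qed
  then show ?thesis
    by (simp add: orbit_antisymmetric_def Az1 Az2 AzH)
qed

lemma difference_in_orbit_antisymmetric:
  "axis (copy1 c) 1 - axis (copy2 c) 1 \<in> orbit_antisymmetric G c"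
proof -
  have "f v = c \<longleftrightarrow> v = c" if "f \<in> Aut_fixing G c" for f v
  proof -
    have "inj f" "f c = c"
      using that by (auto simp: Aut_fixing_def bij_is_inj)
    then show ?thesis
      by (metis injD)
  qed
  then have "orbit_constant G c (\<lambda>v. if v = c then 1 else 0)"
    unfolding orbit_constant_def by metis
  then show ?thesis
    by (simp add: orbit_antisymmetric_def axis_def)
qed

lemma sum_orthogonal_orbit_antisymmetric:
  assumes "z \<in> orbit_antisymmetric G c"
  shows "orthogonal (axis (copy1 c) 1 + axis (copy2 c) 1) z"
  using assms by (simp add: orbit_antisymmetric_def orthogonal_def inner_add_left inner_axis')

section \<open>Cospectrality after connecting an orbit\<close>

theorem lemma3p5:
  fixes G :: "'a::finite \<Rightarrow> 'a \<Rightarrow> bool"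
    and H :: "'b::finite \<Rightarrow> 'b \<Rightarrow> bool"
    and c :: 'a
    and Gt Gh :: "'a + 'a + 'b \<Rightarrow> 'a + 'a + 'b \<Rightarrow> bool"
  assumes "connected_simple_graph G"
    and "connected_simple_graph H"
    and "A_cospectral_construction G H c Gt"
    and "orbit_connecting_modification G c Gt Gh"
  shows "A_cospectral Gh (copy1 c) (copy2 c)"
proof -
  from assms(3) have "symp Gt"
    and Gt11: "\<And>u v. Gt (copy1 u) (copy1 v) \<longleftrightarrow> G u v"
    and Gt22: "\<And>u v. Gt (copy2 u) (copy2 v) \<longleftrightarrow> G u v"
    and Gt12: "\<And>u v. \<not> Gt (copy1 u) (copy2 v)"
    and card: "\<And>w v. card {u \<in> Aut_orbit G c v. Gt (inH w) (copy1 u)} =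
                 card {u \<in> Aut_orbit G c v. Gt (inH w) (copy2 u)}"
    unfolding A_cospectral_construction_def connected_simple_graph_def by blast+
  have Gt21: "\<not> Gt (copy2 u) (copy1 v)" for u v
    using Gt12 \<open>symp Gt\<close> by (auto dest: sympD)
  from assms(4) obtain v0 \<phi> where
    \<phi>: "bij_betw \<phi> (copy1 ` Aut_orbit G c v0) (copy2 ` Aut_orbit G c v0)"
    and Gh: "\<And>x y. Gh x y \<longleftrightarrow> Gt x y \<or>
           (x \<in> copy1 ` Aut_orbit G c v0 \<and> y = \<phi> x) \<or>
           (y \<in> copy1 ` Aut_orbit G c v0 \<and> x = \<phi> y)"
    unfolding orbit_connecting_modification_def by blast
  define O' where "O' = Aut_orbit G c v0"
  define \<psi> where "\<psi> = (\<lambda>u. projl (projr (\<phi> (copy1 u))))"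
  have \<phi>_copy1: "\<phi> (copy1 u) = copy2 (\<psi> u)" if "u \<in> O'" for u
  proof -
    have "\<phi> (copy1 u) \<in> copy2 ` O'"
      using \<phi> that unfolding O'_def bij_betw_def by blast
    then show ?thesis
      by (auto simp: \<psi>_def)
  qed
  have "\<psi> ` O' = O'"
  proof -
    have "copy2 ` \<psi> ` O' = (\<phi> ` copy1 ` O' :: ('a + 'a + 'b) set)"
      using \<phi>_copy1 by (force simp: image_image)
    also have "\<dots> = copy2 ` O'"
      using \<phi> by (simp add: bij_betw_def O'_def)
    finally show ?thesis
      by (subst (asm) inj_image_eq_iff) (auto intro: injI)
  qed
  then have \<psi>: "bij_betw \<psi> O' O'"
    by (simp add: bij_betw_def eq_card_imp_inj_on)
  have "symp Gh"
    using \<open>symp Gt\<close> by (auto simp: symp_def Gh)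
  moreover have "adjacency_matrix Gh *v z \<in> orbit_antisymmetric G c"
    if "z \<in> orbit_antisymmetric G c" for z
  proof (rule orbit_antisymmetric_invariant [where \<psi> = \<psi> and G = G and c = c and ?v0.0 = v0, folded O'_def])
    have copies: "Gh x y \<longleftrightarrow> Gt x y \<or> (\<exists>u \<in> O'. x = copy1 u \<and> y = copy2 (\<psi> u)) \<or>
        (\<exists>u \<in> O'. y = copy1 u \<and> x = copy2 (\<psi> u))" for x y
      unfolding Gh O'_def [symmetric] using \<phi>_copy1 by auto
    show "Gh (copy1 u) (copy1 v) \<longleftrightarrow> G u v" "Gh (copy2 u) (copy2 v) \<longleftrightarrow> G u v"
      "Gh (copy1 u) (copy2 v) \<longleftrightarrow> u \<in> O' \<and> v = \<psi> u"
      "Gh (copy2 v) (copy1 u) \<longleftrightarrow> u \<in> O' \<and> v = \<psi> u" for u v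
      by (auto simp: copies Gt11 Gt22 Gt12 Gt21)
    show "card {u \<in> Aut_orbit G c v. Gh (inH w) (copy1 u)} =
        card {u \<in> Aut_orbit G c v. Gh (inH w) (copy2 u)}" for w v
      using card by (simp add: copies)
  qed (fact \<psi> that)+
  ultimately show ?thesis
    unfolding A_cospectral_def
    by (auto intro: orthogonal_cyclic_subspaces [OF transpose_adjacency_matrix
          subspace_orbit_antisymmetric [of G c] _ difference_in_orbit_antisymmetric
          sum_orthogonal_orbit_antisymmetric])
qed

end
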